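(* Let $S$ be a wattle with chains $Z_1,\dots,Z_t$ ($t>1$) and let $k=|Z_1|$. If $S$ is $P$-faithful, then $S$ is a uniform wattle, i.e.: a) $k\le|Z_i|\le k+1$ for $i=2,\dots,t-1$; b) $|Z_t|=k$; c) if $m$ is the number of indices $i$ such that $|Z_i|=k+1$ ($0\le m\le t-2$), then $m+1$ and $t$ are relatively prime; d) if $u_1<\dots<u_m$ are the elements $u\in\{1,\dots,t\}$ for which $|Z_u|\ne k$, then $u_i=\left[\frac{it}{m+1}\right]+1$ for $i=1,\dots,m$ (integer part). Conversely, if a wattle $S$ satisfies a), b), c) and d), then there exists a vector $\bar x=(x_s)_{s\in S}$ with all $x_s>0$ such that $\sum_{s\in S}r_{s\alpha}x_s=\sum_{s\in S}r_{s\beta}x_s$ for all $\alpha,\beta\in S$.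
   Context: For a finite poset $(S,\le)$ put $R(s,t)=1$ if $s\le t$ and $R(s,t)=0$ otherwise, $f(x)=\sum_{s,t\in S}R(s,t)x_sx_t$, and let $\|\le\|$ be the minimum of $f$ on the standard simplex $\{x\in\mathbb R^S: x_s\ge0,\ \sum_s x_s=1\}$. Put $P(S)=\|\le\|^{-1}$, and $r_{st}=R(s,t)+R(t,s)$ (so $r_{ss}=2$). $S$ is $P$-faithful if $P(S')<P(S)$ for every proper subset $S'\subset S$ with the induced order. A wattle is a finite poset $S$ that is the union of $t>1$ pairwise disjoint chains $Z_1,\dots,Z_t$ with $|Z_i|\ge2$ for all $i$, such that the minimal element of $Z_i$ is smaller than the maximal element of $Z_{i+1}$ for $i=1,\dots,t-1$, and there are no other comparabilities between elements of different chains. *)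

theory Defs
  imports "HOL-Analysis.Analysis"
begin

definition R :: "'a rel \<Rightarrow> 'a \<Rightarrow> 'a \<Rightarrow> real" where
  "R r s t = (if (s, t) \<in> r then 1 else 0)"

definition rsym :: "'a rel \<Rightarrow> 'a \<Rightarrow> 'a \<Rightarrow> real" where
  "rsym r s t = R r s t + R r t s"

definition qform :: "'a set \<Rightarrow> 'a rel \<Rightarrow> ('a \<Rightarrow> real) \<Rightarrow> real" where
  "qform S r x = (\<Sum>s\<in>S. \<Sum>t\<in>S. R r s t * x s * x t)"

definition std_simplex :: "'a set \<Rightarrow> ('a \<Rightarrow> real) set" where
  "std_simplex S = {x \<in> S \<rightarrow>\<^sub>E UNIV. (\<forall>s\<in>S. 0 \<le> x s) \<and> (\<Sum>s\<in>S. x s) = 1}"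

(* The minimum is attained for finite nonempty S; for S = {} the simplex is empty
   and the value is unspecified. *)
definition poset_norm :: "'a set \<Rightarrow> 'a rel \<Rightarrow> real" where
  "poset_norm S r = (LEAST v. v \<in> qform S r ` std_simplex S)"

definition P :: "'a set \<Rightarrow> 'a rel \<Rightarrow> real" where
  "P S r = inverse (poset_norm S r)"

(* The empty subset carries no simplex and is excluded; with the usual convention
   P = 0 for the empty poset it would impose no condition. *)
definition P_faithful :: "'a set \<Rightarrow> 'a rel \<Rightarrow> bool" where
  "P_faithful S r \<longleftrightarrow> (\<forall>S'. S' \<subset> S \<and> S' \<noteq> {} \<longrightarrow> P S' (Restr r S') < P S r)"

definition minimal_in :: "'a rel \<Rightarrow> 'a set \<Rightarrow> 'a \<Rightarrow> bool" where
  "minimal_in r A a \<longleftrightarrow> a \<in> A \<and> (\<forall>b\<in>A. (b, a) \<in> r \<longrightarrow> b = a)"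

definition maximal_in :: "'a rel \<Rightarrow> 'a set \<Rightarrow> 'a \<Rightarrow> bool" where
  "maximal_in r A a \<longleftrightarrow> a \<in> A \<and> (\<forall>b\<in>A. (a, b) \<in> r \<longrightarrow> b = a)"

definition wattle :: "'a set \<Rightarrow> 'a rel \<Rightarrow> nat \<Rightarrow> (nat \<Rightarrow> 'a set) \<Rightarrow> bool" where
  "wattle S r t Z \<longleftrightarrow>
     finite S \<and> partial_order_on S r \<and> t > 1 \<and>
     S = (\<Union>i\<in>{1..t}. Z i) \<and> disjoint_family_on Z {1..t} \<and>
     (\<forall>i\<in>{1..t}. Z i \<in> Chains r \<and> card (Z i) \<ge> 2) \<and>
     (\<forall>i\<in>{1..t - 1}. \<forall>a b. minimal_in r (Z i) a \<and> maximal_in r (Z (i + 1)) b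
        \<longrightarrow> (a, b) \<in> r \<and> a \<noteq> b) \<and>
     (\<forall>i\<in>{1..t}. \<forall>j\<in>{1..t}. \<forall>a\<in>Z i. \<forall>b\<in>Z j. i \<noteq> j \<and> (a, b) \<in> r
        \<longrightarrow> j = i + 1 \<and> minimal_in r (Z i) a \<and> maximal_in r (Z j) b)"

definition uniform_chains :: "nat \<Rightarrow> (nat \<Rightarrow> 'a set) \<Rightarrow> bool" where
  "uniform_chains t Z \<longleftrightarrow>
     (let k = card (Z 1); m = card {i \<in> {1..t}. card (Z i) = k + 1} in
       (\<forall>i\<in>{2..t - 1}. k \<le> card (Z i) \<and> card (Z i) \<le> k + 1) \<and>
       card (Z t) = k \<and>
       m \<le> t - 2 \<and> coprime (m + 1) t \<and>
       (\<exists>u. strict_mono_on {1..m} u \<and> u ` {1..m} = {j \<in> {1..t}. card (Z j) \<noteq> k} \<and>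
            (\<forall>i\<in>{1..m}. u i = i * t div (m + 1) + 1)))"

end

theory Submission
  imports Defs
begin

text \<open>
  Faithfulness forces a minimiser of the quadratic form on the simplex to be strictly positive, so all
  its partial derivatives agree. On a wattle, equality of the partial derivatives means, after
  scaling, that all chains carry the same weight, inner elements weigh \<open>1\<close>, the minimum of
  \<open>Z i\<close> and the maximum of \<open>Z (i + 1)\<close> weigh \<open>1\<close> together, and the maximum
  of \<open>Z 1\<close> and the minimum of \<open>Z t\<close> weigh \<open>1\<close> each. With \<open>A i\<close> the weight of the minimum of \<open>Z i\<close>
  for \<open>i > 0\<close> and \<open>A 0 = 0\<close>, so that \<open>A t = 1\<close>, this reads
  \<open>A i = i * \<theta> - N i\<close> where \<open>N i = \<bar>Z 1\<bar> + \<dots> + \<bar>Z i\<bar>\<close> and \<open>\<theta> = (N t + 1) / t\<close>. A positive solution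
  therefore exists iff \<open>0 < i * \<theta> - N i < 1\<close> for \<open>0 < i < t\<close>, that is, iff no \<open>i * \<theta>\<close> with
  \<open>0 < i < t\<close> is an integer and \<open>N i\<close> is its integer part. Such a sequence of chain lengths takes
  the values \<open>k = \<lfloor>\<theta>\<rfloor>\<close> and \<open>k + 1\<close>, the latter where \<open>i * (m + 1) / t\<close> passes an integer.
\<close>

subsection \<open>Balanced sequences of chain lengths\<close>

text \<open>Cleared of denominators: \<open>0 < i * \<theta> - N i < 1\<close> with \<open>\<theta> = (N t + 1) / t\<close>.\<close>

definition balanced :: "nat \<Rightarrow> (nat \<Rightarrow> nat) \<Rightarrow> bool" where
  "balanced t n \<longleftrightarrow> (\<forall>i\<in>{1..<t}.
     t * sum n {1..i} < i * Suc (sum n {1..t}) \<and>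
     i * Suc (sum n {1..t}) < t * sum n {1..i} + t)"

text \<open>The least \<open>i\<close> with \<open>l < i * p / t\<close>; with \<open>p = m + 1\<close> it is the index \<open>u\<^sub>l\<close> of the paper.\<close>

definition jump :: "nat \<Rightarrow> nat \<Rightarrow> nat \<Rightarrow> nat" where
  "jump t p l = l * t div p + 1"

text \<open>As \<open>p / t < 1\<close>, raising \<open>i\<close> by one raises the integer part of
  \<open>i * p / t\<close> by 0 or 1; this is why only two chain lengths occur.\<close>

lemma mult_div_Suc_bounds:
  fixes p t i :: nat
  assumes "0 < p" "p < t"
  shows "i * p div t \<le> Suc i * p div t" "Suc i * p div t \<le> i * p div t + 1"
proof -
  show "i * p div t \<le> Suc i * p div t"
    by (intro div_le_mono) simp
  have "Suc i * p div t \<le> (i * p + t) div t"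
    using assms by (intro div_le_mono) simp
  then show "Suc i * p div t \<le> i * p div t + 1"
    using assms by simp
qed

lemma not_dvd_mult_of_coprime:
  fixes p t l :: nat
  assumes "coprime p t" "0 < l" "l < p"
  shows "\<not> p dvd l * t"
  using assms by (simp add: coprime_dvd_mult_left_iff nat_dvd_not_less)

text \<open>As \<open>t / p > 1\<close>, the points \<open>l * t / p\<close> are more than 1 apart
  and never share an integer part.\<close>

lemma strict_mono_on_jump:
  assumes "0 < p" "p < t"
  shows "strict_mono_on A (jump t p)"
proof (rule strict_mono_onI)
  fix l l' :: nat
  assume "l < l'"
  have "l * t div p < (l * t + p) div p"
    using assms by simp
  also have "\<dots> \<le> l' * t div p"
  proof (rule div_le_mono)
    have "l * t + p \<le> Suc l * t" using assms by simp
    also have "\<dots> \<le> l' * t" using \<open>l < l'\<close> by (intro mult_le_mono1) simp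
    finally show "l * t + p \<le> l' * t" .
  qed
  finally show "jump t p l < jump t p l'"
    by (simp add: jump_def)
qed

lemma jump_le_iff:
  assumes "0 < p"
  shows "jump t p l \<le> i \<longleftrightarrow> l * t < i * p"
  using assms by (simp add: jump_def div_less_iff_less_mult Suc_le_eq)

text \<open>By coprimality \<open>l * t / p\<close> is not an integer, so it lies strictly between
  \<open>jump t p l - 1\<close> and \<open>jump t p l\<close>. Hence this index is where the integer
  part of \<open>i * p / t\<close> reaches \<open>l\<close>.\<close>

lemma jump_bounds:
  assumes "coprime p t" "p < t" "l \<in> {1..p - 1}"
  shows "jump t p l \<in> {1..<t}"
    and "(jump t p l - 1) * p div t < l"
    and "l \<le> jump t p l * p div t"
proof -
  have p: "0 < p" "l < p" "0 < l" using assms(3) by auto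
  have lt: "l * t < jump t p l * p"
    using jump_le_iff[of p t l "jump t p l"] p by simp
  have "l * t div p * p \<le> l * t" by (rule div_times_less_eq_dividend)
  moreover have "l * t div p * p \<noteq> l * t"
    using not_dvd_mult_of_coprime[OF assms(1) p(3,2)] by (metis dvd_triv_right)
  ultimately have "l * t div p * p < l * t" by linarith
  then have "(jump t p l - 1) * p < l * t" by (simp add: jump_def)
  then show "(jump t p l - 1) * p div t < l"
    using p assms(2) by (simp add: div_less_iff_less_mult)
  show "l \<le> jump t p l * p div t"
    using lt p assms(2) by (simp add: less_eq_div_iff_mult_less_eq)
  \<comment> \<open>From \<open>l < p < t\<close>: \<open>l * t \<le> p * t - t < p * t - p\<close>,
    which keeps the jump below \<open>t\<close>.\<close>
  have "Suc l * t \<le> p * t" using p by (intro mult_le_mono1) simp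
  then have "l * t < (t - 1) * p"
    using assms(2) by (simp add: algebra_simps)
  then have "jump t p l \<le> t - 1"
    using p by (simp add: jump_le_iff)
  then show "jump t p l \<in> {1..<t}"
    using assms(2) p by (auto simp: jump_def)
qed

text \<open>In terms of \<theta> from the overview, \<open>p / t\<close> is the fractional part of
  \<theta>, with integer part \<open>n 1\<close>; taking integer parts of
  \<open>i * \<theta>\<close> then gives the partial sums.\<close>

lemma balanced_sum_eq:
  assumes "balanced t n" "1 < t" "i < t"
  defines "p \<equiv> Suc (sum n {1..t}) - t * n 1"
  shows "sum n {1..i} = i * n 1 + i * p div t" "0 < p" "p < t" "Suc (sum n {1..t}) = t * n 1 + p"
    "coprime p t"
proof -
  have bal: "t * sum n {1..i} < i * Suc (sum n {1..t})"
    "i * Suc (sum n {1..t}) < t * sum n {1..i} + t" if "i \<in> {1..<t}" for i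
    using assms(1) that unfolding balanced_def by auto
  have one: "t * n 1 < Suc (sum n {1..t})" "Suc (sum n {1..t}) < t * n 1 + t"
    using bal[of 1] assms(2) by auto
  then show p: "0 < p" "p < t" and M: "Suc (sum n {1..t}) = t * n 1 + p"
    by (auto simp: p_def)
  show "sum n {1..i} = i * n 1 + i * p div t"
  proof (cases "i = 0")
    case False
    then have i: "i \<in> {1..<t}" using assms(3) by auto
    have "i * Suc (sum n {1..t}) div t = sum n {1..i}"
      using bal[OF i] by (intro div_nat_eqI) (auto simp: mult.commute)
    moreover have "i * Suc (sum n {1..t}) = i * p + t * (i * n 1)"
      unfolding M by (simp add: algebra_simps)
    ultimately show ?thesis
      using assms(2) by simp
  qed simp
  show "coprime p t"
  proof (rule ccontr)
    assume "\<not> coprime p t"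
    then have g: "gcd p t \<noteq> 1" by (simp add: coprime_iff_gcd_eq_1)
    \<comment> \<open>For this \<open>i < t\<close> the number \<open>i * p / t\<close> is an
      integer, so \<open>i * \<theta>\<close> would be an integer strictly between two consecutive
      ones.\<close>
    define i where "i = t div gcd p t"
    have t: "t = i * gcd p t" by (simp add: i_def)
    have "gcd p t \<noteq> 0" using assms(2) by simp
    with g have "1 < gcd p t" by linarith
    moreover have "0 < i" using t assms(2) by (cases i) auto
    ultimately have "i * 1 < i * gcd p t" by simp
    with t have "i < t" by linarith
    with \<open>0 < i\<close> have i: "i \<in> {1..<t}" by simp
    have "i * p = t * (p div gcd p t)"
      by (metis dvd_div_mult_self gcd_dvd1 mult.assoc mult.commute t)
    then have "i * Suc (sum n {1..t}) = t * (i * n 1 + p div gcd p t)"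
      unfolding M by (simp add: algebra_simps)
    then have "t * sum n {1..i} < t * (i * n 1 + p div gcd p t)"
      and "t * (i * n 1 + p div gcd p t) < t * Suc (sum n {1..i})"
      using bal[OF i] by (simp_all del: mult_less_cancel1)
    then show False
      unfolding mult_less_cancel1 by linarith
  qed
qed

text \<open>The difference of two consecutive partial sums, arranged additively so that no integer
  parts are subtracted in \<open>nat\<close>.\<close>

lemma balanced_step:
  assumes "balanced t n" "1 < t" "i \<in> {1..<t}"
  defines "p \<equiv> Suc (sum n {1..t}) - t * n 1"
  shows "n i + (i - 1) * p div t = n 1 + i * p div t"
proof -
  obtain i' where i': "i = Suc i'" using assms(3) by (cases i) auto
  have "sum n {1..i} = sum n {1..i'} + n i" by (simp add: i')
  then show ?thesis
    using balanced_sum_eq(1)[OF assms(1,2), of i] balanced_sum_eq(1)[OF assms(1,2), of i'] assms(3)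
    by (simp add: i' p_def)
qed

text \<open>All \<open>t\<close> lengths add up to \<open>t * n 1 + (p - 1)\<close>, and the first
  \<open>t - 1\<close> of them to \<open>(t - 1) * n 1 + (p - 1)\<close>.\<close>

lemma balanced_last:
  assumes "balanced t n" "1 < t"
  shows "n t = n 1"
proof -
  define p where "p = Suc (sum n {1..t}) - t * n 1"
  obtain s where s: "t = Suc s" using assms(2) by (cases t) auto
  note * = balanced_sum_eq[OF assms, of s, folded p_def]
  \<comment> \<open>Here \<open>s * p / t = p - p / t\<close> with
    \<open>0 < p / t < 1\<close>.\<close>
  have "s * p div t = p - 1"
  proof (rule div_nat_eqI)
    show "t * (p - 1) \<le> s * p" "s * p < t * Suc (p - 1)"
      using * by (auto simp: s algebra_simps)
  qed
  then have "sum n {1..s} = s * n 1 + (p - 1)" "0 < p" "Suc (sum n {1..t}) = t * n 1 + p"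
    using * s by auto
  moreover have "sum n {1..t} = sum n {1..s} + n t" by (simp add: s)
  ultimately have "s * n 1 + p + n t = t * n 1 + p" by linarith
  then show ?thesis by (simp add: s)
qed

section \<open>Equivalence of balance and uniformity\<close>

lemma sum_eq_add_card:
  fixes n :: "nat \<Rightarrow> nat"
  assumes "finite A" "\<And>i. i \<in> A \<Longrightarrow> n i = k \<or> n i = k + 1"
  shows "sum n A = card A * k + card {i\<in>A. n i = k + 1}"
proof -
  have "sum n A = (\<Sum>i\<in>A. k + (if n i = k + 1 then 1 else 0))"
    using assms(2) by (intro sum.cong) auto
  also have "\<dots> = card A * k + card {i\<in>A. n i = k + 1}"
    using assms(1) by (simp add: sum.distrib flip: sum.inter_filter)
  finally show ?thesis .
qed

lemma balanced_imp_uniform_chains: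
  assumes "balanced t (\<lambda>i. card (Z i))" "1 < t"
  shows "uniform_chains t Z"
proof -
  define n where "n = (\<lambda>i. card (Z i))"
  define k where "k = n 1"
  define p where "p = Suc (sum n {1..t}) - t * n 1"
  define m where "m = card {i \<in> {1..t}. n i = k + 1}"
  have bal: "balanced t n" using assms(1) by (simp add: n_def)
  note p = balanced_sum_eq(2-5)[OF bal assms(2), of 0, folded p_def]
  have p: "0 < p" "p < t" "Suc (sum n {1..t}) = t * n 1 + p" "coprime p t"
    using p assms(2) by auto
  note step = balanced_step[OF bal assms(2), folded p_def]
  have last: "n t = k" using balanced_last[OF bal assms(2)] by (simp add: k_def)
  have nk: "n i = k \<or> n i = k + 1" if i: "i \<in> {1..<t}" for i
  proof -
    obtain i' where "i = Suc i'" using i by (cases i) auto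
    then show ?thesis
      using step[OF i] mult_div_Suc_bounds[OF p(1,2), of i'] by (simp add: k_def) linarith
  qed
  have nk': "n i = k \<or> n i = k + 1" if "i \<in> {1..t}" for i
    using that nk[of i] last by (cases "i = t") auto
  have "sum n {1..t} = t * k + m"
    using sum_eq_add_card[of "{1..t}" n k] nk' by (simp add: m_def)
  with p have m: "m + 1 = p" by (simp add: k_def)
  \<comment> \<open>One inclusion suffices: \<open>jump t p\<close> is injective, so its image has
    \<open>m\<close> elements, as many as there are long chains.\<close>
  have "jump t p ` {1..m} = {j \<in> {1..t}. n j = k + 1}"
  proof (rule card_subset_eq)
    have "inj_on (jump t p) {1..m}"
      using strict_mono_on_jump[OF p(1,2)] by (rule strict_mono_on_imp_inj_on)
    then show "card (jump t p ` {1..m}) = card {j \<in> {1..t}. n j = k + 1}"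
      by (simp add: card_image m_def)
    show "jump t p ` {1..m} \<subseteq> {j \<in> {1..t}. n j = k + 1}"
    proof safe
      fix l assume "l \<in> {1..m}"
      then have l: "l \<in> {1..p - 1}" using m by auto
      note j = jump_bounds[OF p(4,2) l]
      then show "jump t p l \<in> {1..t}" by auto
      show "n (jump t p l) = k + 1"
        using step[OF j(1)] j(2,3) nk[OF j(1)] by (auto simp: k_def)
    qed
  qed simp
  also have "\<dots> = {j \<in> {1..t}. n j \<noteq> k}" using nk' by fastforce
  finally have img: "jump t (m + 1) ` {1..m} = {j \<in> {1..t}. n j \<noteq> k}"
    unfolding m .
  have "\<exists>u. strict_mono_on {1..m} u \<and> u ` {1..m} = {j \<in> {1..t}. n j \<noteq> k} \<and>
      (\<forall>i\<in>{1..m}. u i = i * t div (m + 1) + 1)"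
  proof (intro exI conjI ballI)
    show "strict_mono_on {1..m} (jump t (m + 1))"
      using strict_mono_on_jump p m by simp
    show "jump t (m + 1) ` {1..m} = {j \<in> {1..t}. n j \<noteq> k}" by (rule img)
    show "jump t (m + 1) i = i * t div (m + 1) + 1" for i by (rule jump_def)
  qed
  moreover have "\<forall>i\<in>{2..t - 1}. k \<le> n i \<and> n i \<le> k + 1"
  proof
    fix i assume "i \<in> {2..t - 1}"
    then have "i \<in> {1..<t}" by auto
    then show "k \<le> n i \<and> n i \<le> k + 1" using nk[of i] by linarith
  qed
  moreover have "m \<le> t - 2" "coprime (m + 1) t" using p m by auto
  ultimately show ?thesis
    using last unfolding uniform_chains_def Let_def m_def k_def n_def by blast
qed

text \<open>Counting the jumps up to \<open>i\<close> recovers the partial sum as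
  \<open>i * k\<close> plus the integer part of \<open>i * p / t\<close>; coprimality makes both
  inequalities strict.\<close>

lemma uniform_chains_imp_balanced:
  assumes "uniform_chains t Z" "1 < t"
  shows "balanced t (\<lambda>i. card (Z i))"
proof -
  define n where "n = (\<lambda>i. card (Z i))"
  define k where "k = n 1"
  define m where "m = card {i \<in> {1..t}. n i = k + 1}"
  define p where "p = m + 1"
  obtain u where mid: "\<forall>i\<in>{2..t - 1}. k \<le> n i \<and> n i \<le> k + 1" and last: "n t = k"
    and m: "m \<le> t - 2" and cop: "coprime (m + 1) t"
    and img: "u ` {1..m} = {j \<in> {1..t}. n j \<noteq> k}"
    and u: "\<forall>i\<in>{1..m}. u i = i * t div (m + 1) + 1"
    using assms(1) unfolding uniform_chains_def Let_def m_def k_def n_def by blast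
  have p: "0 < p" "p < t" "coprime p t"
    using m cop assms(2) by (auto simp: p_def)
  have nk: "n i = k \<or> n i = k + 1" if "i \<in> {1..t}" for i
  proof -
    consider "i = 1" | "i = t" | "i \<in> {2..t - 1}" using \<open>i \<in> {1..t}\<close> by force
    then have "k \<le> n i \<and> n i \<le> k + 1" using mid last by cases (auto simp: k_def)
    then show ?thesis by linarith
  qed
  have inj: "inj_on (jump t p) A" for A
    using strict_mono_on_jump[OF p(1,2)] by (rule strict_mono_on_imp_inj_on)
  have img': "{j \<in> {1..t}. n j = k + 1} = jump t p ` {1..m}"
  proof -
    have "{j \<in> {1..t}. n j = k + 1} = u ` {1..m}" using nk img by fastforce
    also have "\<dots> = jump t p ` {1..m}"
      using u by (intro image_cong) (auto simp: jump_def p_def)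
    finally show ?thesis .
  qed
  have partial: "sum n {1..i} = i * k + card {l \<in> {1..m}. l * t < i * p}" if "i \<le> t" for i
  proof -
    have "sum n {1..i} = i * k + card {j \<in> {1..i}. n j = k + 1}"
      using sum_eq_add_card[of "{1..i}" n k] nk that by simp
    also have "{j \<in> {1..i}. n j = k + 1} = {j \<in> {j \<in> {1..t}. n j = k + 1}. j \<le> i}"
      using that by auto
    also have "\<dots> = jump t p ` {l \<in> {1..m}. l * t < i * p}"
      unfolding img' using jump_le_iff[OF p(1)] by auto
    also have "card \<dots> = card {l \<in> {1..m}. l * t < i * p}"
      by (rule card_image[OF inj])
    finally show ?thesis .
  qed
  have total: "sum n {1..t} = t * k + m"
  proof -
    have "l * t < t * p" if "l \<in> {1..m}" for l
      using that p(2) mult_less_mono1[of l p t] by (simp add: p_def mult.commute)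
    then have "{l \<in> {1..m}. l * t < t * p} = {1..m}" by auto
    then show ?thesis using partial[of t] by simp
  qed
  have "t * sum n {1..i} < i * Suc (sum n {1..t}) \<and>
     i * Suc (sum n {1..t}) < t * sum n {1..i} + t" if i: "i \<in> {1..<t}" for i
  proof -
    define q where "q = i * p div t"
    have nd: "\<not> t dvd i * p"
      using not_dvd_mult_of_coprime[of t p i] i p(3) by (simp add: coprime_commute)
    then have "i * p mod t \<noteq> 0" by (simp add: dvd_eq_mod_eq_0)
    moreover have "i * p = t * q + i * p mod t" by (simp add: q_def)
    moreover have "i * p mod t < t" using p by simp
    ultimately have q: "t * q < i * p" "i * p < t * q + t" by linarith+
    have "i * p < t * p" using i p by simp
    then have "q < p" using q by (metis mult_less_cancel1 order.strict_trans)
    \<comment> \<open>Since \<open>q < i * p / t < q + 1\<close>, the condition on \<open>l\<close>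
      means \<open>l \<le> q\<close>, and \<open>q < p = m + 1\<close> puts all these
      \<open>l\<close> in range.\<close>
    have "{l \<in> {1..m}. l * t < i * p} = {1..q}"
    proof safe
      fix l assume "l * t < i * p"
      moreover have "(q + 1) * t = t * q + t" by (simp add: algebra_simps)
      ultimately have "l * t < (q + 1) * t" using q(2) by linarith
      then have "l \<le> q" unfolding mult_less_cancel2 by simp
      then show "l \<in> {1..q}" if "l \<in> {1..m}" using that by simp
    next
      fix l assume l: "l \<in> {1..q}"
      then have "l * t \<le> q * t" by (intro mult_le_mono1) simp
      then show "l * t < i * p" using q(1) by (simp only: mult.commute[of q t])
      show "l \<in> {1..m}" using l \<open>q < p\<close> by (auto simp: p_def)
    qed
    then have "sum n {1..i} = i * k + q" using partial[of i] i by simp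
    \<comment> \<open>Subtracting \<open>t\<close> times the partial sum leaves
      \<open>i * p - t * q\<close>, which is strictly between 0 and \<open>t\<close>.\<close>
    moreover have "i * Suc (sum n {1..t}) = t * (i * k) + i * p"
      unfolding total by (simp add: p_def algebra_simps)
    ultimately show ?thesis using q by (simp add: algebra_simps)
  qed
  then show ?thesis by (simp add: balanced_def n_def)
qed

subsection \<open>Minimisers of the quadratic form\<close>

text \<open>By reflexivity the squares are the diagonal terms of the form, and its other terms are
  nonnegative.\<close>

lemma qform_ge_sum_squares:
  assumes "finite S" "\<And>s. s \<in> S \<Longrightarrow> (s, s) \<in> r" "\<And>s. s \<in> S \<Longrightarrow> 0 \<le> x s"
  shows "(\<Sum>s\<in>S. (x s)\<^sup>2) \<le> qform S r x"
  unfolding qform_def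
proof (rule sum_mono)
  fix s assume s: "s \<in> S"
  have "(x s)\<^sup>2 = R r s s * x s * x s"
    using assms(2)[OF s] by (simp add: R_def power2_eq_square)
  also have "\<dots> \<le> (\<Sum>t\<in>S. R r s t * x s * x t)"
    using assms s by (intro member_le_sum) (auto simp: R_def)
  finally show "(x s)\<^sup>2 \<le> (\<Sum>t\<in>S. R r s t * x s * x t)" .
qed

text \<open>For use with \<open>P\<close>: inversion reverses the order of positive norms.\<close>

lemma qform_pos:
  assumes "finite S" "\<And>s. s \<in> S \<Longrightarrow> (s, s) \<in> r" "x \<in> std_simplex S"
  shows "0 < qform S r x"
proof -
  have "\<exists>s\<in>S. x s \<noteq> 0"
  proof (rule ccontr)
    assume "\<not> ?thesis"
    then have "sum x S = 0" by simp
    with assms(3) show False by (simp add: std_simplex_def)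
  qed
  then have "0 < (\<Sum>s\<in>S. (x s)\<^sup>2)"
    using assms(1) by (auto intro: sum_pos2)
  also have "\<dots> \<le> qform S r x"
    using assms by (intro qform_ge_sum_squares) (auto simp: std_simplex_def)
  finally show ?thesis .
qed

lemma qform_Restr: "qform S (Restr r S) x = qform S r x"
  unfolding qform_def by (intro sum.cong) (auto simp: R_def)

lemma qform_cong: "(\<And>s. s \<in> S \<Longrightarrow> x s = y s) \<Longrightarrow> qform S r x = qform S r y"
  unfolding qform_def by (intro sum.cong) auto

lemma compact_std_simplex:
  assumes "finite S"
  shows "compact (std_simplex S :: ('a \<Rightarrow> real) set)"
proof -
  \<comment> \<open>Points of the simplex are extensional, so the factors outside \<open>S\<close>
    are singletons and Tychonoff applies to the product over the whole type.\<close>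
  define B where "B = (\<lambda>i. if i \<in> S then {0..1} else {undefined :: real})"
  have "compact (PiE UNIV B)"
    using compactin_PiE[of "\<lambda>_. euclidean" UNIV B]
    by (simp add: euclidean_product_topology B_def)
  moreover have "closed ((\<lambda>x. \<Sum>s\<in>S. x s) -` {1 :: real})"
    by (intro closed_vimage continuous_on_sum continuous_on_product_coordinates) simp
  moreover have "std_simplex S = PiE UNIV B \<inter> (\<lambda>x. \<Sum>s\<in>S. x s) -` {1}"
  proof (intro equalityI subsetI)
    fix x :: "'a \<Rightarrow> real" assume x: "x \<in> std_simplex S"
    have "x s \<le> 1" if "s \<in> S" for s
      using member_le_sum[OF that, of x] assms x by (auto simp: std_simplex_def)
    with x show "x \<in> PiE UNIV B \<inter> (\<lambda>x. \<Sum>s\<in>S. x s) -` {1}"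
      by (auto simp: std_simplex_def B_def PiE_iff extensional_def)
  next
    fix x :: "'a \<Rightarrow> real" assume "x \<in> PiE UNIV B \<inter> (\<lambda>x. \<Sum>s\<in>S. x s) -` {1}"
    then show "x \<in> std_simplex S"
      by (auto simp: std_simplex_def B_def PiE_iff extensional_def split: if_splits)
  qed
  ultimately show ?thesis by (simp add: compact_Int_closed)
qed

lemma poset_norm_attained:
  assumes "finite S" "S \<noteq> {}"
  obtains x where "x \<in> std_simplex S" "poset_norm S r = qform S r x"
    "\<And>y. y \<in> std_simplex S \<Longrightarrow> qform S r x \<le> qform S r y"
proof -
  obtain a where a: "a \<in> S" using assms(2) by auto
  have "(\<lambda>s\<in>S. if s = a then 1 else 0) \<in> std_simplex S"
    using a assms(1) by (auto simp: std_simplex_def)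
  then have "std_simplex S \<noteq> ({} :: ('a \<Rightarrow> real) set)" by blast
  moreover have "continuous_on (std_simplex S) (qform S r)"
    unfolding qform_def
    by (intro continuous_on_sum continuous_on_mult continuous_on_const
        continuous_on_subset[OF continuous_on_product_coordinates]) auto
  ultimately obtain x where x: "x \<in> std_simplex S"
    and min: "\<And>y. y \<in> std_simplex S \<Longrightarrow> qform S r x \<le> qform S r y"
    using continuous_attains_inf[OF compact_std_simplex[OF assms(1)]] by blast
  have "poset_norm S r = qform S r x"
    unfolding poset_norm_def using x min by (intro Least_equality) auto
  with x min show ?thesis by (intro that)
qed

text \<open>If the coordinate at \<open>s\<close> vanished, the minimiser would restrict to
  \<open>S - {s}\<close> with the same value of the form, so \<open>P\<close> would not drop
  there.\<close>

lemma P_faithful_minimizer_pos: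
  assumes "finite S" "\<And>s. s \<in> S \<Longrightarrow> (s, s) \<in> r" "P_faithful S r"
    and "x \<in> std_simplex S" "poset_norm S r = qform S r x" "s \<in> S"
  shows "0 < x s"
proof (rule ccontr)
  assume "\<not> 0 < x s"
  with assms(4,6) have 0: "x s = 0" by (force simp: std_simplex_def)
  define S' where "S' = S - {s}"
  have S': "finite S'" "S' \<subset> S" "s \<notin> S'" "S = insert s S'"
    using assms(1,6) by (auto simp: S'_def)
  have sum': "(\<Sum>s\<in>S'. x s) = 1"
    using S' 0 assms(4) by (simp add: std_simplex_def)
  then have ne: "S' \<noteq> {}" by auto
  have "restrict x S' \<in> std_simplex S'"
    using S' sum' assms(4) by (auto simp: std_simplex_def)
  moreover obtain y where y: "y \<in> std_simplex S'"
    and ny: "poset_norm S' (Restr r S') = qform S' (Restr r S') y"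
    and min: "\<And>z. z \<in> std_simplex S' \<Longrightarrow> qform S' (Restr r S') y \<le> qform S' (Restr r S') z"
    using poset_norm_attained[OF S'(1) ne] by blast
  ultimately have "poset_norm S' (Restr r S') \<le> qform S' r (restrict x S')"
    by (simp add: qform_Restr)
  also have "\<dots> = qform S' r x" by (rule qform_cong) simp
  also have "\<dots> = qform S r x"
    using S' 0 by (simp add: qform_def)
  finally have le: "poset_norm S' (Restr r S') \<le> poset_norm S r"
    using assms(5) by simp
  have "0 < poset_norm S' (Restr r S')"
    unfolding ny using y S' assms(2) by (intro qform_pos) auto
  with le have "P S r \<le> P S' (Restr r S')"
    unfolding P_def by (rule le_imp_inverse_le)
  moreover have "P S' (Restr r S') < P S r"
    using assms(3) S'(2) ne by (simp add: P_faithful_def)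
  ultimately show False by simp
qed

text \<open>Exact Taylor expansion along the direction that moves mass from \<beta> to \<alpha> and
  keeps the total. The sums with \<open>rsym\<close> are the partial derivatives of the form at
  \<open>x\<close>.\<close>

lemma qform_exchange:
  assumes "finite S" "\<alpha> \<in> S" "\<beta> \<in> S"
  defines "d \<equiv> \<lambda>s. (if s = \<alpha> then 1 else 0) - (if s = \<beta> then 1 else 0) :: real"
  shows "qform S r (\<lambda>s. x s + e * d s) = qform S r x
     + e * ((\<Sum>s\<in>S. rsym r s \<alpha> * x s) - (\<Sum>s\<in>S. rsym r s \<beta> * x s)) + e\<^sup>2 * qform S r d"
proof -
  have 1: "(\<Sum>t\<in>S. g t * d t) = g \<alpha> - g \<beta>" for g :: "'a \<Rightarrow> real"
  proof -
    have "(\<Sum>t\<in>S. g t * d t) = (\<Sum>t\<in>S. (if t = \<alpha> then g t else 0) - (if t = \<beta> then g t else 0))"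
      by (intro sum.cong) (auto simp: d_def)
    then show ?thesis using assms(1-3) by (simp add: sum_subtractf)
  qed
  have "qform S r (\<lambda>s. x s + e * d s) = qform S r x
     + e * ((\<Sum>s\<in>S. x s * (\<Sum>t\<in>S. R r s t * d t)) + (\<Sum>t\<in>S. x t * (\<Sum>s\<in>S. R r s t * d s)))
     + e\<^sup>2 * qform S r d"
    \<comment> \<open>The swap gives all double sums the same order of summation, so that they can
      be compared term by term.\<close>
    unfolding qform_def sum_distrib_left sum.swap[of "\<lambda>t s. x t * (R r s t * d s)"]
    unfolding sum.distrib[symmetric] sum_distrib_left
    unfolding sum.distrib[symmetric]
    by (intro sum.cong refl) (simp add: algebra_simps power2_eq_square)
  also have "(\<Sum>s\<in>S. x s * (\<Sum>t\<in>S. R r s t * d t)) + (\<Sum>t\<in>S. x t * (\<Sum>s\<in>S. R r s t * d s))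
    = (\<Sum>s\<in>S. rsym r s \<alpha> * x s) - (\<Sum>s\<in>S. rsym r s \<beta> * x s)"
    unfolding 1 sum.distrib[symmetric] sum_subtractf[symmetric]
    by (intro sum.cong) (auto simp: rsym_def algebra_simps)
  finally show ?thesis .
qed

text \<open>Otherwise moving a little mass from \<beta> to \<alpha> would lower the form. Exchanging
  \<alpha> and \<beta> turns the inequality into equality.\<close>

lemma minimizer_gradient_le:
  assumes "finite S" "x \<in> std_simplex S" "\<And>s. s \<in> S \<Longrightarrow> 0 < x s"
    and min: "\<And>y. y \<in> std_simplex S \<Longrightarrow> qform S r x \<le> qform S r y"
    and "\<alpha> \<in> S" "\<beta> \<in> S"
  shows "(\<Sum>s\<in>S. rsym r s \<beta> * x s) \<le> (\<Sum>s\<in>S. rsym r s \<alpha> * x s)"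
proof (rule ccontr)
  define d :: "'a \<Rightarrow> real" where
    "d = (\<lambda>s. (if s = \<alpha> then 1 else 0) - (if s = \<beta> then 1 else 0))"
  define L where "L = (\<Sum>s\<in>S. rsym r s \<alpha> * x s) - (\<Sum>s\<in>S. rsym r s \<beta> * x s)"
  define q where "q = qform S r d"
  assume "\<not> ?thesis"
  then have L: "L < 0" by (simp add: L_def)
  then have "\<alpha> \<noteq> \<beta>" by (auto simp: L_def)
  \<comment> \<open>The first bound keeps the coordinate at \<beta> nonnegative; the second makes
    the linear term outweigh the quadratic one.\<close>
  define e where "e = min (x \<beta>) (- L / (1 + \<bar>q\<bar>))"
  have e: "0 < e" "e \<le> x \<beta>"
    using assms(3)[OF assms(6)] L by (auto simp: e_def divide_neg_pos)
  have "e * (1 + \<bar>q\<bar>) \<le> - L / (1 + \<bar>q\<bar>) * (1 + \<bar>q\<bar>)"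
    by (intro mult_right_mono) (auto simp: e_def)
  also have "\<dots> = - L" by simp
  finally have "e + e * \<bar>q\<bar> \<le> - L" by (simp only: distrib_left mult_1_right)
  moreover have "e * q \<le> e * \<bar>q\<bar>" using e by (intro mult_left_mono) auto
  ultimately have "L + e * q < 0" using e(1) by linarith
  then have "e * (L + e * q) < 0" using e by (simp add: mult_pos_neg)
  then have neg: "e * L + e\<^sup>2 * q < 0" by (simp add: algebra_simps power2_eq_square)
  have "(\<Sum>s\<in>S. d s) = 0"
    using assms(1,5,6) by (simp add: d_def sum_subtractf)
  then have "(\<Sum>s\<in>S. x s + e * d s) = 1"
    using assms(2) by (simp add: sum.distrib std_simplex_def flip: sum_distrib_left)
  moreover have "0 \<le> x s + e * d s" if "s \<in> S" for s
    using assms(3)[OF that] e by (auto simp: d_def)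
  ultimately have "(\<lambda>s\<in>S. x s + e * d s) \<in> std_simplex S"
    by (auto simp: std_simplex_def)
  from min[OF this] have "qform S r x \<le> qform S r (\<lambda>s. x s + e * d s)"
    by (simp cong: qform_cong)
  also have "\<dots> = qform S r x + e * L + e\<^sup>2 * q"
    unfolding d_def L_def q_def by (rule qform_exchange[OF assms(1,5,6)])
  finally show False using neg by simp
qed

lemma P_faithful_imp_critical_point:
  assumes "finite S" "S \<noteq> {}" "\<And>s. s \<in> S \<Longrightarrow> (s, s) \<in> r" "P_faithful S r"
  shows "\<exists>x. (\<forall>s\<in>S. 0 < x s) \<and>
    (\<forall>\<alpha>\<in>S. \<forall>\<beta>\<in>S. (\<Sum>s\<in>S. rsym r s \<alpha> * x s) = (\<Sum>s\<in>S. rsym r s \<beta> * x s))"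
proof -
  obtain x where x: "x \<in> std_simplex S" "poset_norm S r = qform S r x"
    "\<And>y. y \<in> std_simplex S \<Longrightarrow> qform S r x \<le> qform S r y"
    using poset_norm_attained[OF assms(1,2)] by blast
  then have pos: "0 < x s" if "s \<in> S" for s
    using P_faithful_minimizer_pos[OF assms(1,3,4)] that by blast
  show ?thesis
    using pos minimizer_gradient_le[OF assms(1) x(1) pos x(3)] by (intro exI[of _ x]) (auto intro: antisym)
qed

subsection \<open>The linear system of a wattle\<close>

text \<open>Stated for any transitive relation, so that \<open>r\<inverse>\<close> yields greatest
  elements.\<close>

lemma finite_chain_least:
  assumes "finite A" "A \<noteq> {}" "A \<in> Chains r" "trans r"
  shows "\<exists>a\<in>A. \<forall>b\<in>A. (a, b) \<in> r"
  using assms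
proof (induction rule: finite_ne_induct)
  case (singleton a)
  then show ?case by (auto simp: Chains_def)
next
  case (insert a A)
  then have "A \<in> Chains r" by (auto simp: Chains_def)
  with insert obtain c where c: "c \<in> A" "\<forall>b\<in>A. (c, b) \<in> r" by auto
  have "(a, a) \<in> r" "(a, c) \<in> r \<or> (c, a) \<in> r"
    using insert.prems(1) c(1) by (auto simp: Chains_def)
  with c \<open>trans r\<close> show ?case by (auto dest: transD)
qed

section \<open>Extremal elements of the chains and comparabilities between chains\<close>

locale wattle_poset =
  fixes S :: "'a set" and r :: "'a rel" and t :: nat and Z :: "nat \<Rightarrow> 'a set"
  assumes wattle: "wattle S r t Z"
begin

definition lo :: "nat \<Rightarrow> 'a" where
  "lo i = (SOME a. a \<in> Z i \<and> (\<forall>b\<in>Z i. (a, b) \<in> r))"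

definition hi :: "nat \<Rightarrow> 'a" where
  "hi i = (SOME a. a \<in> Z i \<and> (\<forall>b\<in>Z i. (b, a) \<in> r))"

lemma
  shows finite_S: "finite S" and t: "1 < t" and S_eq: "S = (\<Union>i\<in>{1..t}. Z i)"
    and po: "partial_order_on S r" and disj_fam: "disjoint_family_on Z {1..t}"
    and chains: "\<forall>i\<in>{1..t}. Z i \<in> Chains r \<and> card (Z i) \<ge> 2"
  using wattle unfolding wattle_def by - (elim conjE, assumption)+

lemma
  shows refl_r: "\<And>s. s \<in> S \<Longrightarrow> (s, s) \<in> r" and trans_r: "trans r" and antisym_r: "antisym r"
  using po unfolding partial_order_on_def preorder_on_def refl_on_def by blast+

lemma disj: "\<lbrakk>s \<in> Z i; s \<in> Z j; i \<in> {1..t}; j \<in> {1..t}\<rbrakk> \<Longrightarrow> i = j"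
  using disj_fam unfolding disjoint_family_on_def by blast

lemma chain: "i \<in> {1..t} \<Longrightarrow> Z i \<in> Chains r"
  and card_Z: "i \<in> {1..t} \<Longrightarrow> 2 \<le> card (Z i)"
  using chains by blast+

lemma Z_sub: "i \<in> {1..t} \<Longrightarrow> Z i \<subseteq> S"
  using S_eq by blast

lemma finite_Z: "i \<in> {1..t} \<Longrightarrow> finite (Z i)"
  using Z_sub finite_S by (rule finite_subset)

lemma lo:
  assumes "i \<in> {1..t}"
  shows "lo i \<in> Z i" "\<forall>b\<in>Z i. (lo i, b) \<in> r"
proof -
  have "Z i \<noteq> {}" using card_Z[OF assms] by auto
  then have "\<exists>a. a \<in> Z i \<and> (\<forall>b\<in>Z i. (a, b) \<in> r)"
    using finite_chain_least[OF finite_Z[OF assms] _ chain[OF assms] trans_r] by blast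
  from someI_ex[OF this] show "lo i \<in> Z i" "\<forall>b\<in>Z i. (lo i, b) \<in> r"
    by (auto simp: lo_def)
qed

lemma hi:
  assumes "i \<in> {1..t}"
  shows "hi i \<in> Z i" "\<forall>b\<in>Z i. (b, hi i) \<in> r"
proof -
  have "Z i \<noteq> {}" using card_Z[OF assms] by auto
  moreover have "Z i \<in> Chains (r\<inverse>)" using chain[OF assms] by (auto simp: Chains_def)
  moreover have "trans (r\<inverse>)" using trans_r by simp
  ultimately have "\<exists>a. a \<in> Z i \<and> (\<forall>b\<in>Z i. (b, a) \<in> r)"
    using finite_chain_least[OF finite_Z[OF assms], of "r\<inverse>"] by blast
  from someI_ex[OF this] show "hi i \<in> Z i" "\<forall>b\<in>Z i. (b, hi i) \<in> r"
    by (auto simp: hi_def)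
qed

lemma lo_neq_hi:
  assumes "i \<in> {1..t}"
  shows "lo i \<noteq> hi i"
proof
  assume "lo i = hi i"
  then have "Z i \<subseteq> {lo i}"
    using lo[OF assms] hi[OF assms] antisym_r by (auto dest: antisymD)
  then have "card (Z i) \<le> 1" using card_mono[of "{lo i}" "Z i"] by simp
  with card_Z[OF assms] show False by simp
qed

lemma minimal_in_iff: "i \<in> {1..t} \<Longrightarrow> minimal_in r (Z i) a \<longleftrightarrow> a = lo i"
  using lo[of i] antisym_r by (auto simp: minimal_in_def dest: antisymD)

lemma maximal_in_iff: "i \<in> {1..t} \<Longrightarrow> maximal_in r (Z i) a \<longleftrightarrow> a = hi i"
  using hi[of i] antisym_r by (auto simp: maximal_in_def dest: antisymD)

lemma comparable:
  "\<forall>i\<in>{1..t}. \<forall>j\<in>{1..t}. \<forall>a\<in>Z i. \<forall>b\<in>Z j. i \<noteq> j \<and> (a, b) \<in> r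
    \<longrightarrow> j = i + 1 \<and> minimal_in r (Z i) a \<and> maximal_in r (Z j) b"
  using wattle unfolding wattle_def by (elim conjE)

lemma linked:
  assumes "i \<in> {1..t - 1}" "minimal_in r (Z i) a" "maximal_in r (Z (i + 1)) b"
  shows "(a, b) \<in> r"
proof -
  have "\<forall>i\<in>{1..t - 1}. \<forall>a b. minimal_in r (Z i) a \<and> maximal_in r (Z (i + 1)) b
      \<longrightarrow> (a, b) \<in> r \<and> a \<noteq> b"
    using wattle unfolding wattle_def by (elim conjE)
  with assms show ?thesis by blast
qed

lemma cross_iff:
  assumes "i \<in> {1..t}" "j \<in> {1..t}" "i \<noteq> j" "a \<in> Z i" "b \<in> Z j"
  shows "(a, b) \<in> r \<longleftrightarrow> j = i + 1 \<and> a = lo i \<and> b = hi j"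
proof
  assume "(a, b) \<in> r"
  then have "j = i + 1 \<and> minimal_in r (Z i) a \<and> maximal_in r (Z j) b"
    using comparable assms by blast
  then show "j = i + 1 \<and> a = lo i \<and> b = hi j"
    using minimal_in_iff[OF assms(1)] maximal_in_iff[OF assms(2)] by blast
next
  assume h: "j = i + 1 \<and> a = lo i \<and> b = hi j"
  then have "i \<in> {1..t - 1}" using assms by auto
  moreover have "minimal_in r (Z i) a" "maximal_in r (Z (i + 1)) b"
    using h assms minimal_in_iff maximal_in_iff by auto
  ultimately show "(a, b) \<in> r"
    by (rule linked)
qed

section \<open>The partial derivatives of the form on a wattle\<close>

lemma rsym_eq:
  assumes "i \<in> {1..t}" "j \<in> {1..t}" "s \<in> Z i" "\<alpha> \<in> Z j"
  shows "rsym r s \<alpha> = (if i = j then 1 else 0) + (if s = \<alpha> then 1 else 0)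
    + (if i = j + 1 \<and> \<alpha> = lo j \<and> s = hi i then 1 else 0)
    + (if j = i + 1 \<and> \<alpha> = hi j \<and> s = lo i then 1 else 0)"
proof (cases "i = j")
  case True
  then have "(s, \<alpha>) \<in> r \<or> (\<alpha>, s) \<in> r" using chain[OF assms(1)] assms by (auto simp: Chains_def)
  with True antisym_r show ?thesis by (auto simp: rsym_def R_def dest: antisymD)
next
  case False
  then have "s \<noteq> \<alpha>" using disj assms by blast
  with False show ?thesis
    using cross_iff[OF assms(1,2) False assms(3,4)] cross_iff[OF assms(2,1) _ assms(4,3)]
    by (auto simp: rsym_def R_def)
qed

lemma gradient_eq:
  assumes j: "j \<in> {1..t}" and \<alpha>: "\<alpha> \<in> Z j"
  shows "(\<Sum>s\<in>S. rsym r s \<alpha> * x s) = sum x (Z j) + x \<alpha>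
    + (if \<alpha> = lo j \<and> j < t then x (hi (j + 1)) else 0)
    + (if \<alpha> = hi j \<and> 1 < j then x (lo (j - 1)) else 0)"
proof -
  \<comment> \<open>Each link condition is recast as \<open>s\<close> being one fixed element, so
    that its sum collapses; the guards \<open>j < t\<close> and \<open>1 < j\<close> exclude missing
    neighbours.\<close>
  have "(\<Sum>s\<in>S. rsym r s \<alpha> * x s) = (\<Sum>s\<in>S. (if s \<in> Z j then x s else 0)
     + (if s = \<alpha> then x s else 0)
     + (if s = hi (j + 1) then if \<alpha> = lo j \<and> j < t then x s else 0 else 0)
     + (if s = lo (j - 1) then if \<alpha> = hi j \<and> 1 < j then x s else 0 else 0))"
  proof (rule sum.cong)
    fix s assume "s \<in> S"
    then obtain i where i: "i \<in> {1..t}" "s \<in> Z i" using S_eq by auto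
    have "s \<in> Z j \<longleftrightarrow> i = j" using i j disj by auto
    moreover have "i = j + 1 \<and> \<alpha> = lo j \<and> s = hi i \<longleftrightarrow> s = hi (j + 1) \<and> \<alpha> = lo j \<and> j < t"
      using i j disj[of s i "j + 1"] hi(1)[of "j + 1"] by auto
    moreover have "j = i + 1 \<and> \<alpha> = hi j \<and> s = lo i \<longleftrightarrow> s = lo (j - 1) \<and> \<alpha> = hi j \<and> 1 < j"
    proof (cases "1 < j")
      case True
      then have "j - 1 \<in> {1..t}" using j by auto
      then show ?thesis using i j disj[of s i "j - 1"] lo(1)[of "j - 1"] True by auto
    qed (use i in auto)
    ultimately show "rsym r s \<alpha> * x s = (if s \<in> Z j then x s else 0)
     + (if s = \<alpha> then x s else 0)
     + (if s = hi (j + 1) then if \<alpha> = lo j \<and> j < t then x s else 0 else 0)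
     + (if s = lo (j - 1) then if \<alpha> = hi j \<and> 1 < j then x s else 0 else 0)"
      unfolding rsym_eq[OF i(1) j i(2) \<alpha>] by (simp add: distrib_right)
  qed simp
  also have "\<dots> = sum x (Z j) + x \<alpha>
    + (if \<alpha> = lo j \<and> j < t then x (hi (j + 1)) else 0)
    + (if \<alpha> = hi j \<and> 1 < j then x (lo (j - 1)) else 0)"
  proof -
    have "S \<inter> Z j = Z j" "\<alpha> \<in> S" using Z_sub[OF j] \<alpha> by auto
    moreover have "hi (j + 1) \<in> S" if "j < t" using hi(1)[of "j + 1"] Z_sub[of "j + 1"] that by auto
    moreover have "lo (j - 1) \<in> S" if "1 < j"
    proof -
      have "j - 1 \<in> {1..t}" using that j by auto
      from lo(1)[OF this] Z_sub[OF this] show ?thesis by blast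
    qed
    ultimately show ?thesis
      using finite_S by (simp add: sum.distrib flip: sum.inter_restrict)
  qed
  finally show ?thesis .
qed

section \<open>Solving the equations of a critical point\<close>

lemma sum_chain:
  fixes x :: "'a \<Rightarrow> real"
  assumes i: "i \<in> {1..t}" and w: "\<And>s. \<lbrakk>s \<in> Z i; s \<noteq> lo i; s \<noteq> hi i\<rbrakk> \<Longrightarrow> x s = w"
  shows "sum x (Z i) = (real (card (Z i)) - 2) * w + x (lo i) + x (hi i)"
proof -
  have sub: "{lo i, hi i} \<subseteq> Z i" using lo(1)[OF i] hi(1)[OF i] by auto
  have "sum x (Z i) = sum x (Z i - {lo i, hi i}) + sum x {lo i, hi i}"
    by (rule sum.subset_diff[OF sub finite_Z[OF i]])
  also have "sum x (Z i - {lo i, hi i}) = real (card (Z i - {lo i, hi i})) * w"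
    using w by simp
  also have "card (Z i - {lo i, hi i}) = card (Z i) - 2"
    using sub lo_neq_hi[OF i] by (subst card_Diff_subset) auto
  finally show ?thesis
    using card_Z[OF i] lo_neq_hi[OF i] by (simp add: of_nat_diff)
qed

text \<open>Without the scaling of the overview: \<open>w\<close> is the unit of weight,
  \<open>c\<close> the common partial derivative, and \<theta> is \<open>c / w\<close>.\<close>

lemma critical_point_imp_balanced:
  fixes x :: "'a \<Rightarrow> real"
  assumes pos: "\<And>s. s \<in> S \<Longrightarrow> 0 < x s"
    and crit: "\<And>\<alpha> \<beta>. \<lbrakk>\<alpha> \<in> S; \<beta> \<in> S\<rbrakk> \<Longrightarrow>
      (\<Sum>s\<in>S. rsym r s \<alpha> * x s) = (\<Sum>s\<in>S. rsym r s \<beta> * x s)"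
  shows "balanced t (\<lambda>i. card (Z i))"
proof -
  define c where "c = (\<Sum>s\<in>S. rsym r s (lo t) * x s)"
  have in_t: "t \<in> {1..t}" "1 \<in> {1..t}" using t by auto
  have grad: "sum x (Z j) + x \<alpha>
    + (if \<alpha> = lo j \<and> j < t then x (hi (j + 1)) else 0)
    + (if \<alpha> = hi j \<and> 1 < j then x (lo (j - 1)) else 0) = c" if "j \<in> {1..t}" "\<alpha> \<in> Z j" for j \<alpha>
  proof -
    have "\<alpha> \<in> S" "lo t \<in> S" using that lo(1)[OF in_t(1)] Z_sub in_t by blast+
    then show ?thesis
      unfolding gradient_eq[OF that, symmetric] c_def by (rule crit)
  qed
  define w where "w = x (lo t)"
  define A where "A = (\<lambda>i. if i = 0 then 0 else x (lo i))"
  have glo: "sum x (Z i) + x (lo i) + (if i < t then x (hi (i + 1)) else 0) = c" if "i \<in> {1..t}" for i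
    using grad[OF that, of "lo i"] lo(1)[OF that] lo_neq_hi[OF that] by simp
  have ghi: "sum x (Z i) + x (hi i) + A (i - 1) = c" if "i \<in> {1..t}" for i
    using grad[OF that, of "hi i"] hi(1)[OF that] lo_neq_hi[OF that] that by (auto simp: A_def)
  \<comment> \<open>The equations at \<open>lo i\<close> and \<open>hi (Suc i)\<close> contain the
    same two extra terms \<open>x (lo i)\<close> and \<open>x (hi (Suc i))\<close>.\<close>
  have step: "sum x (Z i) = sum x (Z (Suc i))" if "i \<in> {1..<t}" for i
    using glo[of i] ghi[of "Suc i"] that by (simp add: A_def)
  \<comment> \<open>Descending induction from \<open>t\<close>: the minimum of the last chain has no
    link, so its equation gives the value.\<close>
  have X: "sum x (Z i) = c - w" if "i \<in> {1..t}" for i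
  proof -
    from that have "i \<le> t" by simp
    then show ?thesis using \<open>i \<in> {1..t}\<close>
    proof (induction rule: inc_induct)
      case base
      then show ?case using glo[of t] in_t by (simp add: w_def)
    next
      case (step n)
      then show ?case using \<open>\<And>i. i \<in> {1..<t} \<Longrightarrow> _\<close>[of n] by auto
    qed
  qed
  have hi_eq: "x (hi i) = w - A (i - 1)" if "i \<in> {1..t}" for i
    using ghi[OF that] X[OF that] by simp
  have inner: "x s = w" if "i \<in> {1..t}" "s \<in> Z i" "s \<noteq> lo i" "s \<noteq> hi i" for i s
    using grad[OF that(1,2)] X[OF that(1)] that by simp
  have recur: "A i - A (i - 1) = c - w + w - real (card (Z i)) * w" if i: "i \<in> {1..t}" for i
  proof -
    have "sum x (Z i) = (real (card (Z i)) - 2) * w + x (lo i) + x (hi i)"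
      using i by (rule sum_chain) (rule inner[OF i])
    moreover have "x (lo i) = A i" using i by (simp add: A_def)
    ultimately show ?thesis
      unfolding X[OF i] hi_eq[OF i] by (simp add: algebra_simps)
  qed
  have A: "A i = real i * c - real (\<Sum>j=1..i. card (Z j)) * w" if "i \<le> t" for i
    using that
  proof (induction i)
    case 0
    then show ?case by (simp add: A_def)
  next
    case (Suc i)
    then show ?case using recur[of "Suc i"] by (simp add: algebra_simps)
  qed
  have wpos: "0 < w" using pos lo(1)[OF in_t(1)] Z_sub[OF in_t(1)] by (auto simp: w_def)
  define M where "M = Suc (\<Sum>j=1..t. card (Z j))"
  \<comment> \<open>This is the closed form of \<open>A\<close> at \<open>t\<close>, where
    \<open>A t = w\<close>.\<close>
  have c: "real t * c = real M * w"
    using A[of t] t by (simp add: A_def w_def M_def algebra_simps)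
  have "t * (\<Sum>j=1..i. card (Z j)) < i * M \<and> i * M < t * (\<Sum>j=1..i. card (Z j)) + t"
    if i: "i \<in> {1..<t}" for i
  proof -
    let ?N = "\<Sum>j=1..i. card (Z j)"
    have i': "i \<in> {1..t}" "Suc i \<in> {1..t}" using i by auto
    have "0 < A i" using pos lo(1)[OF i'(1)] Z_sub[OF i'(1)] i by (auto simp: A_def)
    \<comment> \<open>This is positivity at the maximum of the next chain, whose weight is
      \<open>w - A i\<close>.\<close>
    moreover have "A i < w" 
      using hi_eq[OF i'(2)] pos hi(1)[OF i'(2)] Z_sub[OF i'(2)] by fastforce
    ultimately have "0 < real t * A i" "real t * A i < real t * w" using t by auto
    moreover have "real t * A i = (real (i * M) - real (t * ?N)) * w"
    proof -
      have "real t * A i = real i * (real t * c) - real (t * ?N) * w"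
        using i by (subst A) (auto simp: algebra_simps)
      then show ?thesis unfolding c by (simp add: algebra_simps)
    qed
    ultimately have "0 < real (i * M) - real (t * ?N)" "real (i * M) - real (t * ?N) < real t"
      using wpos by (simp_all add: zero_less_mult_iff)
    then show ?thesis by linarith
  qed
  then show ?thesis by (simp add: balanced_def M_def)
qed

text \<open>The closed form of \<open>A\<close> with \<open>w = 1\<close> now serves to define the
  weights; balance makes them positive, and the common partial derivative is \<theta>.\<close>

lemma balanced_imp_critical_point:
  assumes "balanced t (\<lambda>i. card (Z i))"
  shows "\<exists>x :: 'a \<Rightarrow> real. (\<forall>s\<in>S. 0 < x s) \<and>
    (\<forall>\<alpha>\<in>S. \<forall>\<beta>\<in>S. (\<Sum>s\<in>S. rsym r s \<alpha> * x s) = (\<Sum>s\<in>S. rsym r s \<beta> * x s))"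
proof -
  define \<theta> where "\<theta> = real (Suc (\<Sum>j=1..t. card (Z j))) / real t"
  define A where "A = (\<lambda>i. real i * \<theta> - real (\<Sum>j=1..i. card (Z j)))"
  have A0: "A 0 = 0" by (simp add: A_def)
  have At: "A t = 1" using t by (simp add: A_def \<theta>_def)
  have A_step: "A i - A (i - 1) = \<theta> - real (card (Z i))" if "i \<in> {1..t}" for i
    using that by (cases i) (auto simp: A_def algebra_simps)
  have A_bounds: "0 < A i" "A i < 1" if "i \<in> {1..<t}" for i
  proof -
    let ?N = "\<Sum>j=1..i. card (Z j)" and ?M = "Suc (\<Sum>j=1..t. card (Z j))"
    have "t * ?N < i * ?M" "i * ?M < t * ?N + t"
      using assms that unfolding balanced_def by auto
    then have "real (t * ?N) < real (i * ?M)" "real (i * ?M) < real (t * ?N + t)"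
      by (simp_all only: of_nat_less_iff)
    moreover have "real t * A i = real (i * ?M) - real (t * ?N)"
      using t by (simp add: A_def \<theta>_def field_simps)
    ultimately have "0 < real t * A i" "real t * A i < real t * 1" by simp_all
    then show "0 < A i" "A i < 1" using t by (simp_all add: zero_less_mult_iff)
  qed
  define ix where "ix = (\<lambda>s. THE i. i \<in> {1..t} \<and> s \<in> Z i)"
  have ix: "ix s = i" if "i \<in> {1..t}" "s \<in> Z i" for i s
    unfolding ix_def using that disj by (intro the_equality) auto
  \<comment> \<open>As \<open>A 0 = 0\<close> and \<open>A t = 1\<close>, the two unlinked ends, the
    maximum of \<open>Z 1\<close> and the minimum of \<open>Z t\<close>, get weight 1 like the inner
    elements.\<close>
  define x where "x = (\<lambda>s. if s = lo (ix s) then A (ix s)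
     else if s = hi (ix s) then 1 - A (ix s - 1) else 1)"
  have xlo: "x (lo i) = A i" if "i \<in> {1..t}" for i
    using ix[OF that] lo(1)[OF that] by (simp add: x_def)
  have xhi: "x (hi i) = 1 - A (i - 1)" if "i \<in> {1..t}" for i
    using ix[OF that] hi(1)[OF that] lo_neq_hi[OF that] by (simp add: x_def)
  have xin: "x s = 1" if "i \<in> {1..t}" "s \<in> Z i" "s \<noteq> lo i" "s \<noteq> hi i" for i s
    using ix[OF that(1,2)] that by (simp add: x_def)
  have X: "sum x (Z i) = \<theta> - 1" if i: "i \<in> {1..t}" for i
  proof -
    have "sum x (Z i) = (real (card (Z i)) - 2) * 1 + x (lo i) + x (hi i)"
      using i by (rule sum_chain) (rule xin[OF i])
    then show ?thesis
      unfolding xlo[OF i] xhi[OF i] using A_step[OF i] by simp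
  qed
  \<comment> \<open>The chain contributes \<open>\<theta> - 1\<close>; the element together with its
    linked partner, if any, contributes 1.\<close>
  have "(\<Sum>s\<in>S. rsym r s \<alpha> * x s) = \<theta>" if \<alpha>: "\<alpha> \<in> S" for \<alpha>
  proof -
    obtain j where j: "j \<in> {1..t}" "\<alpha> \<in> Z j" using \<alpha> S_eq by auto
    consider "\<alpha> = lo j" | "\<alpha> = hi j" | "\<alpha> \<noteq> lo j" "\<alpha> \<noteq> hi j" by blast
    then show ?thesis
    proof cases
      case 1
      show ?thesis
        unfolding gradient_eq[OF j] X[OF j(1)] using 1 xlo[OF j(1)] lo_neq_hi[OF j(1)] xhi[of "j + 1"] j At
        by (cases "j = t") auto
    next
      case 2
      have "x (lo (j - 1)) = A (j - 1)" if "j \<noteq> 1" using j that by (intro xlo) auto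
      then show ?thesis
        unfolding gradient_eq[OF j] X[OF j(1)] using 2 xhi[OF j(1)] lo_neq_hi[OF j(1)] j A0
        by (cases "j = 1") auto
    next
      case 3
      then show ?thesis
        unfolding gradient_eq[OF j] X[OF j(1)] using xin[OF j] by simp
    qed
  qed
  moreover have "0 < x s" if s: "s \<in> S" for s
  proof -
    obtain j where j: "j \<in> {1..t}" "s \<in> Z j" using s S_eq by auto
    have "0 < A j" using A_bounds[of j] At j by (cases "j = t") auto
    moreover have "A (j - 1) < 1"
    proof (cases "j = 1")
      case False
      then show ?thesis using j by (intro A_bounds) auto
    qed (simp add: A0)
    ultimately show ?thesis
      using xlo[OF j(1)] xhi[OF j(1)] xin[OF j] by (cases "s = lo j"; cases "s = hi j") auto
  qed
  ultimately show ?thesis by (intro exI[of _ x]) auto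
qed

end

theorem proposition2:
  fixes S :: "'a set" and r :: "'a rel" and t :: nat and Z :: "nat \<Rightarrow> 'a set"
  assumes "wattle S r t Z"
  shows "(P_faithful S r \<longrightarrow> uniform_chains t Z) \<and>
    (uniform_chains t Z \<longrightarrow>
      (\<exists>x :: 'a \<Rightarrow> real. (\<forall>s\<in>S. x s > 0) \<and>
        (\<forall>\<alpha>\<in>S. \<forall>\<beta>\<in>S. (\<Sum>s\<in>S. rsym r s \<alpha> * x s) = (\<Sum>s\<in>S. rsym r s \<beta> * x s))))"
proof (intro conjI impI)
  interpret wattle_poset S r t Z by unfold_locales (rule assms)
  {
    assume faithful: "P_faithful S r"
    have "lo 1 \<in> S" using lo(1)[of 1] Z_sub[of 1] t by auto
    then have "S \<noteq> {}" by auto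
    then obtain x where "\<forall>s\<in>S. 0 < x s"
      "\<forall>\<alpha>\<in>S. \<forall>\<beta>\<in>S. (\<Sum>s\<in>S. rsym r s \<alpha> * x s) = (\<Sum>s\<in>S. rsym r s \<beta> * x s)"
      using P_faithful_imp_critical_point[OF finite_S _ refl_r faithful] by blast
    then have "balanced t (\<lambda>i. card (Z i))"
      by (intro critical_point_imp_balanced[of x]) blast+
    then show "uniform_chains t Z"
      using t by (rule balanced_imp_uniform_chains)
  }
  assume "uniform_chains t Z"
  then have "balanced t (\<lambda>i. card (Z i))"
    using t by (rule uniform_chains_imp_balanced)
  then show "\<exists>x :: 'a \<Rightarrow> real. (\<forall>s\<in>S. x s > 0) \<and>
      (\<forall>\<alpha>\<in>S. \<forall>\<beta>\<in>S. (\<Sum>s\<in>S. rsym r s \<alpha> * x s) = (\<Sum>s\<in>S. rsym r s \<beta> * x s))"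
    by (rule balanced_imp_critical_point)
qed

end
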